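(* Let $G$ be a graph with at least one edge, of order $p$ and size $q$, with vertex set $V(G)=\{v_1,\ldots,v_p\}$. (a) $\chi_{lat}(G)\le \chi_{la}(G\vee K_1)-1$, and equality holds if $\chi(G)=\chi_{la}(G\vee K_1)-1$. (b) Suppose $\chi_{lat}(G)=\chi(G\vee K_1)-1$ and let $f$ be a corresponding local antimagic total labeling of $G$ (i.e. one inducing exactly $\chi_{lat}(G)$ distinct vertex weights). If $\sum_{i=1}^{p}f(v_i)\ne w_f(v_j)$ for all $1\le j\le p$, then $\chi_{la}(G\vee K_1)=\chi(G\vee K_1)$.
   Context: Graphs are finite and simple; $\chi$ is the usual chromatic number. $G\vee K_1$ is the join: the graph obtained from $G$ by adding one new vertex adjacent to every vertex of $G$. A local antimagic labeling of a graph $H$ of size $m$ is a bijection $g:E(H)\to\{1,\ldots,m\}$ such that $g^+(u)\ne g^+(v)$ for every edge $uv$ of $H$, where $g^+(u)=\sum_{ux\in E(H)}g(ux)$; $\chi_{la}(H)$ is the minimum number of distinct values of $g^+$ over all local antimagic labelings $g$ of $H$. For a graph $G$ of order $p$ and size $q$, a local antimagic total labeling of $G$ is a bijection $f:V(G)\cup E(G)\to\{1,\ldots,p+q\}$ such that $w_f(u)\neq w_f(v)$ for every edge $uv$ of $G$, where $w_f(u)=f(u)+\sum_{ux\in E(G)}f(ux)$; $\chi_{lat}(G)$ is the minimum number of distinct values of $w_f$ over all local antimagic total labelings $f$ of $G$. *)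

theory Defs
  imports Main
begin

record 'a sgraph =
  verts :: "'a set"
  edges :: "'a set set"

definition finite_simple_graph :: "'a sgraph \<Rightarrow> bool" where
  "finite_simple_graph G \<longleftrightarrow>
     finite (verts G) \<and> (\<forall>e\<in>edges G. e \<subseteq> verts G \<and> card e = 2)"

text \<open>The join of \<open>G\<close> with \<open>K\<^sub>1\<close>: \<open>None\<close> is the new vertex.\<close>

definition join_K1 :: "'a sgraph \<Rightarrow> 'a option sgraph" where
  "join_K1 G = \<lparr>
     verts = insert None (Some ` verts G),
     edges = (\<lambda>e. Some ` e) ` edges G \<union> {{None, Some v} | v. v \<in> verts G} \<rparr>"

definition proper_colouring :: "'a sgraph \<Rightarrow> nat \<Rightarrow> ('a \<Rightarrow> nat) \<Rightarrow> bool" where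
  "proper_colouring G k c \<longleftrightarrow>
     c ` verts G \<subseteq> {..<k} \<and> (\<forall>u v. {u, v} \<in> edges G \<longrightarrow> c u \<noteq> c v)"

definition chi :: "'a sgraph \<Rightarrow> nat" where
  "chi G = (LEAST k. \<exists>c. proper_colouring G k c)"

definition edge_weight :: "'a sgraph \<Rightarrow> ('a set \<Rightarrow> nat) \<Rightarrow> 'a \<Rightarrow> nat" where
  "edge_weight H g u = (\<Sum>x | {u, x} \<in> edges H. g {u, x})"

definition local_antimagic :: "'a sgraph \<Rightarrow> ('a set \<Rightarrow> nat) \<Rightarrow> bool" where
  "local_antimagic H g \<longleftrightarrow>
     bij_betw g (edges H) {1..card (edges H)} \<and>
     (\<forall>u v. {u, v} \<in> edges H \<longrightarrow> edge_weight H g u \<noteq> edge_weight H g v)"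

text \<open>
  The minimum is over a nonempty set only if \<open>H\<close> has a local antimagic labeling
  (\<open>K\<^sub>2\<close>, for instance, has none). If \<open>G\<close> has an edge then \<open>G \<or> K\<^sub>1\<close> has one:
  label the edges of \<open>G\<close> by \<open>1, \<dots>, q\<close> arbitrarily, and give the labels
  \<open>q + 1, \<dots>, q + p\<close> to the remaining edges in increasing order of the sums so far
  at their end-vertices in \<open>G\<close>.
\<close>

definition chi_la :: "'a sgraph \<Rightarrow> nat" where
  "chi_la H = (LEAST k. \<exists>g. local_antimagic H g \<and> card (edge_weight H g ` verts H) = k)"

text \<open>A total labeling is a function on the disjoint union of vertices and edges.\<close>

definition total_weight :: "'a sgraph \<Rightarrow> ('a + 'a set \<Rightarrow> nat) \<Rightarrow> 'a \<Rightarrow> nat" where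
  "total_weight G f u = f (Inl u) + (\<Sum>x | {u, x} \<in> edges G. f (Inr {u, x}))"

definition local_antimagic_total :: "'a sgraph \<Rightarrow> ('a + 'a set \<Rightarrow> nat) \<Rightarrow> bool" where
  "local_antimagic_total G f \<longleftrightarrow>
     bij_betw f (verts G <+> edges G) {1..card (verts G) + card (edges G)} \<and>
     (\<forall>u v. {u, v} \<in> edges G \<longrightarrow> total_weight G f u \<noteq> total_weight G f v)"

definition chi_lat :: "'a sgraph \<Rightarrow> nat" where
  "chi_lat G = (LEAST k. \<exists>f. local_antimagic_total G f \<and> card (total_weight G f ` verts G) = k)"

end

theory Submission imports Defs begin

text \<open>
  The edges of \<open>G \<or> K\<^sub>1\<close> are in bijection with the vertices and edges of \<open>G\<close>: a vertex \<open>v\<close>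
  corresponds to the edge joining it to the new vertex. Transporting labels along this bijection
  (\<open>join_edge\<close>) turns an edge labeling of \<open>G \<or> K\<^sub>1\<close> into a total labeling of \<open>G\<close>, under which the
  weight of each old vertex is unchanged while the new vertex has the sum of all vertex labels as
  its weight. As the new vertex is adjacent to all others, local antimagic labelings of \<open>G \<or> K\<^sub>1\<close>
  are exactly the local antimagic total labelings of \<open>G\<close> for which that sum is the weight of no
  vertex (\<open>local_antimagic_join_iff\<close>), and the former have precisely one more weight
  (\<open>card_weights_join\<close>).

  Both parts follow by applying this to an optimal labeling of one side, together with
  the fact that weights form a proper colouring, so that \<open>\<chi>\<close> is a lower bound for both
  \<open>\<chi>\<^sub>l\<^sub>a\<close> and \<open>\<chi>\<^sub>l\<^sub>a\<^sub>t\<close>. Since these invariants are least elements, one must also know that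
  a labeling exists at all (\<open>local_antimagic_join_exists\<close>); otherwise the least
  number would be unspecified and would bound nothing.
\<close>

section \<open>Neighbours and colourings\<close>

lemma finite_edges: "finite_simple_graph G \<Longrightarrow> finite (edges G)"
  unfolding finite_simple_graph_def by (meson PowI finite_Pow_iff finite_subset subsetI)

lemma edge_ends:
  assumes "finite_simple_graph G" "{u, x} \<in> edges G"
  shows "u \<in> verts G" "x \<in> verts G" "u \<noteq> x"
  using assms unfolding finite_simple_graph_def by (auto simp: card_insert_if)

lemma finite_neighbours:
  "finite_simple_graph G \<Longrightarrow> finite {x. {u, x} \<in> edges G}"
  by (rule finite_subset[of _ "verts G"])
    (auto dest: edge_ends simp: finite_simple_graph_def)

text \<open>
  The values of \<open>c\<close> may be any numbers; numbering the values that occur consecutively turns \<open>c\<close>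
  into a colouring with as many colours as it has values.
\<close>

lemma chi_le_card_image:
  fixes c :: "'a \<Rightarrow> nat"
  assumes G: "finite_simple_graph G"
    and c: "\<And>u x. {u, x} \<in> edges G \<Longrightarrow> c u \<noteq> c x"
  shows "chi G \<le> card (c ` verts G)"
proof -
  have "finite (c ` verts G)"
    using G by (simp add: finite_simple_graph_def)
  then obtain h where h: "bij_betw h (c ` verts G) {..<card (c ` verts G)}"
    using ex_bij_betw_finite_nat lessThan_atLeast0 by metis
  have "h (c u) \<noteq> h (c x)" if "{u, x} \<in> edges G" for u x
    using c[OF that] edge_ends[OF G that] inj_onD[OF bij_betw_imp_inj_on[OF h]] by blast
  moreover have "(h \<circ> c) ` verts G \<subseteq> {..<card (c ` verts G)}"
    using bij_betw_imp_surj_on[OF h] by (simp add: image_comp)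
  ultimately have "proper_colouring G (card (c ` verts G)) (h \<circ> c)"
    unfolding proper_colouring_def by simp
  then show ?thesis
    unfolding chi_def by (intro Least_le exI)
qed

section \<open>Total labelings as edge labelings of the join\<close>

definition join_edge :: "'a + 'a set \<Rightarrow> 'a option set" where
  "join_edge = case_sum (\<lambda>v. {None, Some v}) (\<lambda>e. Some ` e)"

lemma join_edge_simps [simp]:
  "join_edge (Inl v) = {None, Some v}" "join_edge (Inr e) = Some ` e"
  by (simp_all add: join_edge_def)

lemma inj_join_edge: "inj join_edge"
proof (rule injI)
  fix a b :: "'a + 'a set"
  assume eq: "join_edge a = join_edge b"
  have "Some ` e \<noteq> insert None A" for e :: "'a set" and A
    by blast
  then show "a = b"
    using eq by (cases a; cases b)
      (auto simp: doubleton_eq_iff inj_image_eq_iff dest: sym)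
qed

text \<open>
  Thus every total labeling is the transport of some edge labeling. Injectivity on the whole type,
  and not only on the vertices and edges of \<open>G\<close>, makes this an equation between functions.
\<close>

lemma transport_join_edge: "\<exists>g. f = g \<circ> join_edge"
proof
  show "f = (f \<circ> inv join_edge) \<circ> join_edge"
    by (simp add: comp_assoc inv_o_cancel[OF inj_join_edge])
qed

lemma edges_join: "edges (join_K1 G) = join_edge ` (verts G <+> edges G)"
  by (auto simp: join_K1_def Plus_def image_Un image_image)

lemma verts_join: "verts (join_K1 G) = insert None (Some ` verts G)"
  by (simp add: join_K1_def)

lemma join_edge_mem_edges_join [simp]: "join_edge s \<in> edges (join_K1 G) \<longleftrightarrow> s \<in> verts G <+> edges G"
  unfolding edges_join by (rule inj_image_mem_iff[OF inj_join_edge])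

lemma Some_Some_edge_join [simp]: "{Some u, Some x} \<in> edges (join_K1 G) \<longleftrightarrow> {u, x} \<in> edges G"
  using join_edge_mem_edges_join[of "Inr {u, x}" G] by (auto simp del: join_edge_mem_edges_join)

lemma None_Some_edge_join [simp]: "{None, Some u} \<in> edges (join_K1 G) \<longleftrightarrow> u \<in> verts G"
  using join_edge_mem_edges_join[of "Inl u" G] by (auto simp del: join_edge_mem_edges_join)

lemma Some_None_edge_join [simp]: "{Some u, None} \<in> edges (join_K1 G) \<longleftrightarrow> u \<in> verts G"
  by (simp add: insert_commute)

lemma None_None_edge_join [simp]: "{None, None} \<notin> edges (join_K1 G)"
proof
  assume "{None, None} \<in> edges (join_K1 G)"
  then obtain s where "{None} = join_edge s"
    unfolding edges_join by auto
  then show False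
    by (cases s) auto
qed

lemma card_edges_join:
  assumes "finite_simple_graph G"
  shows "card (edges (join_K1 G)) = card (verts G) + card (edges G)"
  using assms finite_edges[OF assms]
  by (simp add: edges_join card_image[OF inj_on_subset[OF inj_join_edge subset_UNIV]]
      card_Plus finite_simple_graph_def)

lemma finite_simple_graph_join:
  assumes G: "finite_simple_graph G"
  shows "finite_simple_graph (join_K1 G)"
proof -
  have "Some ` e \<subseteq> verts (join_K1 G)" "card (Some ` e) = 2" if "e \<in> edges G" for e
    using G that by (auto simp: verts_join finite_simple_graph_def card_image)
  then show ?thesis
    using G by (auto simp: finite_simple_graph_def join_K1_def)
qed

lemma edge_weight_join_None:
  "edge_weight (join_K1 G) g None = (\<Sum>v\<in>verts G. (g \<circ> join_edge) (Inl v))"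
proof -
  have "{x. {None, x} \<in> edges (join_K1 G)} = Some ` verts G"
    by (auto simp: image_iff) (metis None_None_edge_join None_Some_edge_join not_None_eq insert_absorb2)
  then show ?thesis
    by (simp add: edge_weight_def sum.reindex)
qed

lemma edge_weight_join_Some:
  assumes G: "finite_simple_graph G" and u: "u \<in> verts G"
  shows "edge_weight (join_K1 G) g (Some u) = total_weight G (g \<circ> join_edge) u"
proof -
  have "{x. {Some u, x} \<in> edges (join_K1 G)} = insert None (Some ` {x. {u, x} \<in> edges G})" (is "?A = ?B")
  proof (rule set_eqI)
    fix x show "x \<in> ?A \<longleftrightarrow> x \<in> ?B"
      using u by (cases x) auto
  qed
  then show ?thesis
    using finite_neighbours[OF G, of u]
    by (simp add: edge_weight_def total_weight_def sum.reindex insert_commute[of "Some u" None])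
qed

lemma bij_betw_join_iff:
  "bij_betw (g \<circ> join_edge) (verts G <+> edges G) N \<longleftrightarrow> bij_betw g (edges (join_K1 G)) N"
proof -
  have "bij_betw join_edge (verts G <+> edges G) (edges (join_K1 G))"
    unfolding edges_join by (rule inj_on_imp_bij_betw[OF inj_on_subset[OF inj_join_edge subset_UNIV]])
  then show ?thesis
    by (rule bij_betw_comp_iff[symmetric])
qed

text \<open>
  The edges of \<open>G \<or> K\<^sub>1\<close> that come from \<open>G\<close> impose the condition on total labelings; the
  additional condition is what the edges at the new vertex impose.
\<close>

lemma local_antimagic_join_iff:
  assumes G: "finite_simple_graph G"
  shows "local_antimagic (join_K1 G) g \<longleftrightarrow>
    local_antimagic_total G (g \<circ> join_edge) \<and>
    (\<forall>u\<in>verts G. (\<Sum>v\<in>verts G. (g \<circ> join_edge) (Inl v)) \<noteq> total_weight G (g \<circ> join_edge) u)"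
proof -
  let ?w = "edge_weight (join_K1 G) g"
  have "(\<forall>a b. {a, b} \<in> edges (join_K1 G) \<longrightarrow> ?w a \<noteq> ?w b) \<longleftrightarrow>
      (\<forall>u x. {u, x} \<in> edges G \<longrightarrow> ?w (Some u) \<noteq> ?w (Some x)) \<and>
      (\<forall>u\<in>verts G. ?w None \<noteq> ?w (Some u))" (is "?L \<longleftrightarrow> ?R")
  proof
    assume ?R
    show ?L
    proof (intro allI impI)
      fix a b assume "{a, b} \<in> edges (join_K1 G)"
      with \<open>?R\<close> show "?w a \<noteq> ?w b"
        by (cases a; cases b) (auto simp del: insert_absorb2 dest: not_sym)
    qed
  qed auto
  moreover have "(\<forall>u x. {u, x} \<in> edges G \<longrightarrow> ?w (Some u) \<noteq> ?w (Some x)) \<longleftrightarrow>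
      (\<forall>u x. {u, x} \<in> edges G \<longrightarrow>
        total_weight G (g \<circ> join_edge) u \<noteq> total_weight G (g \<circ> join_edge) x)"
    using edge_ends[OF G] edge_weight_join_Some[OF G] by metis
  moreover have "(\<forall>u\<in>verts G. ?w None \<noteq> ?w (Some u)) \<longleftrightarrow>
      (\<forall>u\<in>verts G. (\<Sum>v\<in>verts G. (g \<circ> join_edge) (Inl v)) \<noteq> total_weight G (g \<circ> join_edge) u)"
    unfolding edge_weight_join_None using edge_weight_join_Some[OF G] by metis
  ultimately show ?thesis
    unfolding local_antimagic_def local_antimagic_total_def bij_betw_join_iff card_edges_join[OF G]
    by blast
qed

lemma card_weights_join:
  assumes G: "finite_simple_graph G" and g: "local_antimagic (join_K1 G) g"
  shows "card (edge_weight (join_K1 G) g ` verts (join_K1 G)) =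
    Suc (card (total_weight G (g \<circ> join_edge) ` verts G))"
proof -
  have "edge_weight (join_K1 G) g ` verts (join_K1 G) =
      insert (\<Sum>v\<in>verts G. (g \<circ> join_edge) (Inl v)) (total_weight G (g \<circ> join_edge) ` verts G)"
    unfolding verts_join image_insert image_image edge_weight_join_None
    using edge_weight_join_Some[OF G] by (metis (no_types, lifting) image_cong)
  moreover have "(\<Sum>v\<in>verts G. (g \<circ> join_edge) (Inl v)) \<notin> total_weight G (g \<circ> join_edge) ` verts G"
    using g unfolding local_antimagic_join_iff[OF G] by blast
  ultimately show ?thesis
    using G by (simp add: finite_simple_graph_def)
qed

section \<open>Existence of a local antimagic labeling of the join\<close>

text \<open>
  List \<open>V\<close> in increasing order of \<open>s\<close> and let \<open>h\<close> be the position in the list. Elements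
  with equal values of \<open>s\<close> get different positions; this is what makes the vertex weights
  distinct when \<open>h\<close> is added to \<open>s\<close>.
\<close>

lemma ex_bij_betw_monotone:
  fixes s :: "'a \<Rightarrow> nat"
  assumes "finite V"
  shows "\<exists>h. bij_betw h V {1..card V} \<and> (\<forall>u\<in>V. \<forall>x\<in>V. h u < h x \<longrightarrow> s u \<le> s x)"
proof -
  obtain ys where ys: "set ys = V" "distinct ys"
    using finite_distinct_list[OF assms] by blast
  define xs where "xs = sort_key s ys"
  have len: "length xs = card V"
    using distinct_card[OF ys(2)] ys(1) by (simp add: xs_def)
  have bij: "bij_betw (\<lambda>i. xs ! (i - 1)) {1..card V} V"
  proof -
    have "bij_betw ((!) xs) {..<card V} V"
      by (rule bij_betw_nth) (use len ys in \<open>simp_all add: xs_def\<close>)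
    moreover have "bij_betw (\<lambda>i. i - 1) {1..card V} {..<card V}"
      by (rule bij_betw_byWitness[where f' = Suc]) auto
    ultimately show "bij_betw (\<lambda>i. xs ! (i - 1)) {1..card V} V"
      using bij_betw_trans[of "\<lambda>i. i - 1" _ _ "(!) xs"] by (simp add: comp_def)
  qed
  define h where "h = inv_into {1..card V} (\<lambda>i. xs ! (i - 1))"
  have h: "bij_betw h V {1..card V}"
    unfolding h_def by (rule bij_betw_inv_into[OF bij])
  have nth_h: "xs ! (h u - 1) = u" if "u \<in> V" for u
    unfolding h_def using bij_betw_inv_into_right[OF bij that] .
  have "s u \<le> s x" if "u \<in> V" "x \<in> V" "h u < h x" for u x
  proof -
    have "h x \<in> {1..card V}"
      using bij_betwE[OF h] that by blast
    then have "map s xs ! (h u - 1) \<le> map s xs ! (h x - 1)"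
      using that(3) by (intro sorted_nth_mono) (use len in \<open>auto simp: xs_def\<close>)
    moreover have "h u - 1 < length xs" "h x - 1 < length xs"
      using \<open>h x \<in> _\<close> that(3) len by auto
    ultimately show ?thesis
      using nth_h that by simp
  qed
  with h show ?thesis by blast
qed

text \<open>
  Label the edges first, by \<open>1, \<dots>, q\<close>, and give the larger labels to the vertices in
  increasing order of the sums of their edge labels. Then all vertex weights are distinct. The sum
  of all vertex labels exceeds each of them: in comparing it with the weight of \<open>u\<close>, the label
  of \<open>u\<close> cancels, every edge label at \<open>u\<close> is beaten by the vertex label at the other
  end, and there is at least one vertex other than \<open>u\<close>.
\<close>

lemma local_antimagic_total_exists:
  assumes G: "finite_simple_graph G" and two: "2 \<le> card (verts G)"
  shows "\<exists>f. local_antimagic_total G f \<and>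
    (\<forall>u\<in>verts G. (\<Sum>v\<in>verts G. f (Inl v)) \<noteq> total_weight G f u)"
proof -
  define p q where "p = card (verts G)" and "q = card (edges G)"
  have finV: "finite (verts G)"
    using G by (simp add: finite_simple_graph_def)
  obtain l where l: "bij_betw l (edges G) {1..q}"
    unfolding q_def using finite_same_card_bij[OF finite_edges[OF G], of "{1..card (edges G)}"] by auto
  define s where "s u = (\<Sum>x | {u, x} \<in> edges G. l {u, x})" for u
  obtain h where h: "bij_betw h (verts G) {1..p}"
    and mono: "\<And>u x. \<lbrakk>u \<in> verts G; x \<in> verts G; h u < h x\<rbrakk> \<Longrightarrow> s u \<le> s x"
    using ex_bij_betw_monotone[OF finV, of s] unfolding p_def by blast
  define f where "f = case_sum (\<lambda>v. q + h v) l"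
  have weight: "total_weight G f u = q + h u + s u" for u
    by (simp add: total_weight_def f_def s_def)
  have bij: "bij_betw f (verts G <+> edges G) {1..p + q}"
  proof -
    have "bij_betw (\<lambda>v. q + h v) (verts G) {q + 1..q + p}"
      using bij_betw_trans[OF h, of "(+) q" "{q + 1..q + p}"]
      by (simp add: comp_def bij_betw_def)
    then have "bij_betw f (Inl ` verts G) {q + 1..q + p}" "bij_betw f (Inr ` edges G) {1..q}"
      using l by (auto simp: f_def bij_betw_def inj_on_def image_image)
    then have "bij_betw f (Inl ` verts G \<union> Inr ` edges G) ({q + 1..q + p} \<union> {1..q})"
      by (rule bij_betw_combine) auto
    moreover have "{q + 1..q + p} \<union> {1..q} = {1..p + q}"
      by auto
    ultimately show ?thesis
      by (simp add: Plus_def)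
  qed
  have "total_weight G f u \<noteq> total_weight G f x" if "{u, x} \<in> edges G" for u x
  proof -
    have ends: "u \<in> verts G" "x \<in> verts G" "u \<noteq> x"
      using edge_ends[OF G that] .
    then have "h u \<noteq> h x"
      using inj_onD[OF bij_betw_imp_inj_on[OF h]] by blast
    then show ?thesis
      using mono[of u x] mono[of x u] ends unfolding weight by (cases "h u < h x") auto
  qed
  moreover have "total_weight G f u < (\<Sum>v\<in>verts G. f (Inl v))" if u: "u \<in> verts G" for u
  proof -
    let ?N = "{x. {u, x} \<in> edges G}"
    have sub: "?N \<subseteq> verts G - {u}"
      using edge_ends[OF G] by blast
    have pos: "0 < h x" if "x \<in> verts G" for x
      using bij_betwE[OF h] that by force
    have le: "l e \<le> q" if "e \<in> edges G" for e
      using bij_betwE[OF l] that by force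
    have ne: "verts G - {u} \<noteq> {}"
    proof
      assume "verts G - {u} = {}"
      then have "card (verts G) \<le> card {u}"
        by (intro card_mono) auto
      then show False
        using two by simp
    qed
    have "s u = (\<Sum>x\<in>verts G - {u}. if x \<in> ?N then l {u, x} else 0)"
      unfolding s_def by (rule sum.mono_neutral_cong_left) (use sub finV in auto)
    also have "\<dots> < (\<Sum>x\<in>verts G - {u}. f (Inl x))"
      using finV ne pos by (intro sum_strict_mono) (auto simp: f_def intro!: le_less_trans[OF le])
    finally show ?thesis
      unfolding weight using u finV by (simp add: sum.remove f_def)
  qed
  ultimately show ?thesis
    using bij unfolding local_antimagic_total_def p_def q_def by (metis less_irrefl)
qed

lemma local_antimagic_join_exists:
  assumes G: "finite_simple_graph G" and "edges G \<noteq> {}"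
  shows "\<exists>g. local_antimagic (join_K1 G) g"
proof -
  obtain e where "e \<subseteq> verts G" "card e = 2"
    using assms unfolding finite_simple_graph_def by blast
  then have "2 \<le> card (verts G)"
    using G card_mono[of "verts G" e] by (simp add: finite_simple_graph_def)
  from local_antimagic_total_exists[OF G this] show ?thesis
    using local_antimagic_join_iff[OF G] transport_join_edge by metis
qed

section \<open>Comparison of the invariants\<close>

lemma chi_la_attained:
  assumes "local_antimagic H g"
  obtains g' where "local_antimagic H g'" "card (edge_weight H g' ` verts H) = chi_la H"
proof -
  have "\<exists>g'. local_antimagic H g' \<and> card (edge_weight H g' ` verts H) = chi_la H"
    unfolding chi_la_def by (rule LeastI[where k = "card (edge_weight H g ` verts H)"]) (use assms in blast)
  then show ?thesis using that by blast
qed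

lemma chi_lat_attained:
  assumes "local_antimagic_total G f"
  obtains f' where "local_antimagic_total G f'" "card (total_weight G f' ` verts G) = chi_lat G"
proof -
  have "\<exists>f'. local_antimagic_total G f' \<and> card (total_weight G f' ` verts G) = chi_lat G"
    unfolding chi_lat_def by (rule LeastI[where k = "card (total_weight G f ` verts G)"]) (use assms in blast)
  then show ?thesis using that by blast
qed

lemma chi_la_le: "local_antimagic H g \<Longrightarrow> chi_la H \<le> card (edge_weight H g ` verts H)"
  unfolding chi_la_def by (rule Least_le) blast

lemma chi_lat_le: "local_antimagic_total G f \<Longrightarrow> chi_lat G \<le> card (total_weight G f ` verts G)"
  unfolding chi_lat_def by (rule Least_le) blast

lemma chi_le_chi_la:
  assumes "finite_simple_graph H" "local_antimagic H g"
  shows "chi H \<le> chi_la H"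
  using assms(2)
proof (rule chi_la_attained)
  fix g' assume "local_antimagic H g'" "card (edge_weight H g' ` verts H) = chi_la H"
  then show ?thesis
    using chi_le_card_image[OF assms(1), of "edge_weight H g'"] by (simp add: local_antimagic_def)
qed

lemma chi_le_chi_lat:
  assumes "finite_simple_graph G" "local_antimagic_total G f"
  shows "chi G \<le> chi_lat G"
  using assms(2)
proof (rule chi_lat_attained)
  fix f' assume "local_antimagic_total G f'" "card (total_weight G f' ` verts G) = chi_lat G"
  then show ?thesis
    using chi_le_card_image[OF assms(1), of "total_weight G f'"] by (simp add: local_antimagic_total_def)
qed

theorem theorem2p7:
  fixes G :: "'a sgraph" and p q :: nat and v :: "nat \<Rightarrow> 'a"
  assumes "finite_simple_graph G"
    and "edges G \<noteq> {}"
    and "card (verts G) = p"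
    and "card (edges G) = q"
    and "bij_betw v {1..p} (verts G)"
  shows "(int (chi_lat G) \<le> int (chi_la (join_K1 G)) - 1 \<and>
          (int (chi G) = int (chi_la (join_K1 G)) - 1 \<longrightarrow>
             int (chi_lat G) = int (chi_la (join_K1 G)) - 1)) \<and>
         (\<forall>f. int (chi_lat G) = int (chi (join_K1 G)) - 1 \<and>
              local_antimagic_total G f \<and>
              card (total_weight G f ` verts G) = chi_lat G \<and>
              (\<forall>j\<in>{1..p}. (\<Sum>i=1..p. f (Inl (v i))) \<noteq> total_weight G f (v j)) \<longrightarrow>
              chi_la (join_K1 G) = chi (join_K1 G))"
proof -
  note G = assms(1)
  obtain g0 where "local_antimagic (join_K1 G) g0"
    using local_antimagic_join_exists[OF G assms(2)] by blast
  then obtain g where g: "local_antimagic (join_K1 G) g"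
    and opt: "card (edge_weight (join_K1 G) g ` verts (join_K1 G)) = chi_la (join_K1 G)"
    by (rule chi_la_attained)
  have f: "local_antimagic_total G (g \<circ> join_edge)"
    using g unfolding local_antimagic_join_iff[OF G] by blast
  have upper: "Suc (chi_lat G) \<le> chi_la (join_K1 G)"
    using chi_lat_le[OF f] card_weights_join[OF G g] opt by simp
  have "chi_la (join_K1 G) = chi (join_K1 G)"
    if lat: "int (chi_lat G) = int (chi (join_K1 G)) - 1"
      and f': "local_antimagic_total G f'" "card (total_weight G f' ` verts G) = chi_lat G"
      and ne: "\<forall>j\<in>{1..p}. (\<Sum>i=1..p. f' (Inl (v i))) \<noteq> total_weight G f' (v j)" for f'
  proof -
    obtain g' where g': "f' = g' \<circ> join_edge"
      using transport_join_edge by blast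
    have "(\<Sum>i=1..p. f' (Inl (v i))) = (\<Sum>u\<in>verts G. f' (Inl u))"
      by (rule sum.reindex_bij_betw[OF assms(5)])
    then have "\<forall>u\<in>verts G. (\<Sum>u\<in>verts G. f' (Inl u)) \<noteq> total_weight G f' u"
      using ne bij_betw_imp_surj_on[OF assms(5)] by (metis imageE)
    with f' have la: "local_antimagic (join_K1 G) g'"
      unfolding local_antimagic_join_iff[OF G] g' by blast
    have "chi_la (join_K1 G) \<le> chi (join_K1 G)"
      using chi_la_le[OF la] card_weights_join[OF G la] f'(2) lat g' by simp
    moreover have "chi (join_K1 G) \<le> chi_la (join_K1 G)"
      by (rule chi_le_chi_la[OF finite_simple_graph_join[OF G] la])
    ultimately show ?thesis by simp
  qed
  then show ?thesis
    using upper chi_le_chi_lat[OF G f] by auto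
qed

end
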